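(* Let $\{\eta^i_q\in V_{\mathbb{H}}^R \mid i=1,\dots,n,\ q\in\mathbb{H}\}$ be a rank $n$ right quaternionic continuous frame with frame operator $A$ and bounds $m(A)$ and $M(A)$. Let $\{\zeta^i_q\in V_{\mathbb{H}}^R \mid i=1,\dots,n,\ q\in\mathbb{H}\}$ be any family satisfying $$\sum_{i=1}^{n}\int_{\mathbb{H}}\left\|\eta^i_q-\zeta^i_q\right\|^2\,d\mu(q)<m(A).$$ Then $\{\eta^i_q+\zeta^i_q \mid i=1,\dots,n,\ q\in\mathbb{H}\}$ is a rank $n$ continuous frame in $V_{\mathbb{H}}^R$.
   Context: $\mathbb{H}$ denotes the quaternions, equipped with a fixed measure $\mu$; $n\ge 1$ is an integer. $V_{\mathbb{H}}^R$ is a separable right quaternionic Hilbert space, whose inner product $\langle\cdot|\cdot\rangle$ is $\mathbb{H}$-valued with $\overline{\langle\phi|\psi\rangle}=\langle\psi|\phi\rangle$, $\langle\phi|\psi p\rangle=\langle\phi|\psi\rangle p$, $\langle\phi p|\psi\rangle=\overline{p}\langle\phi|\psi\rangle$. Operators are right linear. Families are assumed measurable in $q$ so that the integrals make sense; operator integrals are understood weakly, with $|\eta\rangle\langle\zeta|\,\phi=\eta\langle\zeta|\phi\rangle$. Rank $n$ right quaternionic continuous frame: a family $\{\eta^i_q\}$ such that for each $q$ the vectors $\eta^1_q,\dots,\eta^n_q$ are linearly independent, and there is a positive operator $A$ on $V_{\mathbb{H}}^R$, bounded with bounded inverse, with $\sum_{i=1}^n\int_{\mathbb{H}}|\eta^i_q\rangle\langle\eta^i_q|\,d\mu(q)=A$.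 $A$ is its frame operator, and its bounds are $m(A)=\inf_{\|\phi\|=1}\langle\phi|A\phi\rangle$ and $M(A)=\sup_{\|\phi\|=1}\langle\phi|A\phi\rangle$. Rank $n$ continuous frame (for a general family $\{\xi^i_q\}$, no linear independence required): there exist $C,D>0$ with $C\|\phi\|^2\le\sum_{i=1}^n\int_{\mathbb{H}}|\langle\xi^i_q|\phi\rangle|^2\,d\mu(q)\le D\|\phi\|^2$ for all $\phi\in V_{\mathbb{H}}^R$. *)

theory Defs
  imports "HOL-Analysis.Analysis"
begin

section \<open>Quaternions\<close>

codatatype quat = Quat (qRe: real) (qIm1: real) (qIm2: real) (qIm3: real)

lemma quat_eq_iff: "x = y \<longleftrightarrow> qRe x = qRe y \<and> qIm1 x = qIm1 y \<and> qIm2 x = qIm2 y \<and> qIm3 x = qIm3 y"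
  by (auto intro: quat.expand)

instantiation quat :: ab_group_add
begin

primcorec zero_quat where
  "qRe 0 = 0" | "qIm1 0 = 0" | "qIm2 0 = 0" | "qIm3 0 = 0"

primcorec plus_quat where
  "qRe (x + y) = qRe x + qRe y"
| "qIm1 (x + y) = qIm1 x + qIm1 y"
| "qIm2 (x + y) = qIm2 x + qIm2 y"
| "qIm3 (x + y) = qIm3 x + qIm3 y"

primcorec uminus_quat where
  "qRe (- x) = - qRe x"
| "qIm1 (- x) = - qIm1 x"
| "qIm2 (- x) = - qIm2 x"
| "qIm3 (- x) = - qIm3 x"

primcorec minus_quat where
  "qRe (x - y) = qRe x - qRe y"
| "qIm1 (x - y) = qIm1 x - qIm1 y"
| "qIm2 (x - y) = qIm2 x - qIm2 y"
| "qIm3 (x - y) = qIm3 x - qIm3 y"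

instance
  by standard (simp_all add: quat_eq_iff)

end

instantiation quat :: real_vector
begin

primcorec scaleR_quat where
  "qRe (scaleR r x) = r * qRe x"
| "qIm1 (scaleR r x) = r * qIm1 x"
| "qIm2 (scaleR r x) = r * qIm2 x"
| "qIm3 (scaleR r x) = r * qIm3 x"

instance
  by standard (simp_all add: quat_eq_iff algebra_simps)

end

instantiation quat :: real_algebra_1
begin

primcorec one_quat where
  "qRe 1 = 1" | "qIm1 1 = 0" | "qIm2 1 = 0" | "qIm3 1 = 0"

primcorec times_quat where
  "qRe (x * y) = qRe x * qRe y - qIm1 x * qIm1 y - qIm2 x * qIm2 y - qIm3 x * qIm3 y"
| "qIm1 (x * y) = qRe x * qIm1 y + qIm1 x * qRe y + qIm2 x * qIm3 y - qIm3 x * qIm2 y"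
| "qIm2 (x * y) = qRe x * qIm2 y - qIm1 x * qIm3 y + qIm2 x * qRe y + qIm3 x * qIm1 y"
| "qIm3 (x * y) = qRe x * qIm3 y + qIm1 x * qIm2 y - qIm2 x * qIm1 y + qIm3 x * qRe y"

instance
  by standard (simp_all add: quat_eq_iff algebra_simps)

end

primcorec qcnj :: "quat \<Rightarrow> quat" where
  "qRe (qcnj x) = qRe x"
| "qIm1 (qcnj x) = - qIm1 x"
| "qIm2 (qcnj x) = - qIm2 x"
| "qIm3 (qcnj x) = - qIm3 x"

instantiation quat :: real_inner
begin

definition inner_quat_def:
  "inner x y = qRe x * qRe y + qIm1 x * qIm1 y + qIm2 x * qIm2 y + qIm3 x * qIm3 y"

definition norm_quat_def:
  "norm x = sqrt ((qRe x)\<^sup>2 + (qIm1 x)\<^sup>2 + (qIm2 x)\<^sup>2 + (qIm3 x)\<^sup>2)"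

definition sgn_quat_def: "sgn x = x /\<^sub>R norm x" for x :: quat

definition dist_quat_def: "dist x y = norm (x - y)" for x y :: quat

definition uniformity_quat_def [code del]:
  "(uniformity :: (quat \<times> quat) filter) = (INF e\<in>{0 <..}. principal {(x, y). dist x y < e})"

definition open_quat_def [code del]:
  "open (U :: quat set) \<longleftrightarrow> (\<forall>x\<in>U. eventually (\<lambda>(x', y). x' = x \<longrightarrow> y \<in> U) uniformity)"

instance
proof
  fix x y z :: quat and r :: real and U :: "quat set"
  show "inner x y = inner y x"
    by (simp add: inner_quat_def mult.commute)
  show "inner (x + y) z = inner x z + inner y z"
    by (simp add: inner_quat_def algebra_simps)
  show "inner (r *\<^sub>R x) y = r * inner x y"
    by (simp add: inner_quat_def algebra_simps)
  show "0 \<le> inner x x"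
    by (simp add: inner_quat_def)
  show "inner x x = 0 \<longleftrightarrow> x = 0"
    by (simp add: inner_quat_def quat_eq_iff add_nonneg_eq_0_iff)
  show "norm x = sqrt (inner x x)"
    by (simp add: inner_quat_def norm_quat_def power2_eq_square)
qed (rule sgn_quat_def dist_quat_def uniformity_quat_def open_quat_def)+

end

instantiation quat :: real_normed_div_algebra
begin

definition inverse_quat_def: "inverse x = qcnj x /\<^sub>R (norm x)\<^sup>2"

definition divide_quat_def: "x div y = x * inverse y" for x y :: quat

instance
proof
  fix x y :: quat
  have nz: "(qRe x)\<^sup>2 + (qIm1 x)\<^sup>2 + (qIm2 x)\<^sup>2 + (qIm3 x)\<^sup>2 \<noteq> 0" if "x \<noteq> 0"
    using that by (auto simp: quat_eq_iff add_nonneg_eq_0_iff)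
  have n2: "(norm x)\<^sup>2 = (qRe x)\<^sup>2 + (qIm1 x)\<^sup>2 + (qIm2 x)\<^sup>2 + (qIm3 x)\<^sup>2"
    by (simp add: norm_quat_def)
  have n2': "qcnj x * x = (norm x)\<^sup>2 *\<^sub>R 1" "x * qcnj x = (norm x)\<^sup>2 *\<^sub>R 1"
    unfolding n2 by (simp_all add: quat_eq_iff power2_eq_square algebra_simps)
  show "x \<noteq> 0 \<Longrightarrow> inverse x * x = 1" "x \<noteq> 0 \<Longrightarrow> x * inverse x = 1"
    by (simp_all add: inverse_quat_def n2')
  show "x div y = x * inverse y"
    by (rule divide_quat_def)
  show "inverse (0 :: quat) = 0"
    by (simp add: inverse_quat_def norm_quat_def quat_eq_iff)
  show "norm (x * y) = norm x * norm y"
    unfolding norm_quat_def real_sqrt_mult [symmetric]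
    by (rule arg_cong [where f = sqrt]) (simp add: power2_eq_square algebra_simps)
qed

end

instantiation quat :: euclidean_space
begin

definition Basis_quat_def: "Basis = {Quat 1 0 0 0, Quat 0 1 0 0, Quat 0 0 1 0, Quat 0 0 0 1}"

instance
proof
  fix u v x :: quat
  show "(Basis :: quat set) \<noteq> {}" "finite (Basis :: quat set)"
    by (simp_all add: Basis_quat_def)
  show "inner u v = (if u = v then 1 else 0)" if "u \<in> Basis" "v \<in> Basis"
    using that unfolding Basis_quat_def by (elim insertE emptyE) (simp_all add: inner_quat_def)
  show "(\<forall>u\<in>Basis. inner x u = 0) \<longleftrightarrow> x = 0"
    unfolding Basis_quat_def ball_simps quat_eq_iff [of x] by (simp add: inner_quat_def)
qed

end

lemma of_real_quat_sel [simp]: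
  "qRe (of_real r) = r" "qIm1 (of_real r) = 0" "qIm2 (of_real r) = 0" "qIm3 (of_real r) = 0"
  by (simp_all add: of_real_def)

lemma qcnj_add: "qcnj (x + y) = qcnj x + qcnj y"
  by (simp add: quat_eq_iff)

lemma qcnj_mult: "qcnj (x * y) = qcnj y * qcnj x"
  by (simp add: quat_eq_iff algebra_simps)

lemma qcnj_mult_self: "qcnj x * x = of_real ((norm x)\<^sup>2)"
  by (simp add: norm_quat_def quat_eq_iff power2_eq_square algebra_simps)


section \<open>Separable right quaternionic Hilbert spaces\<close>

text \<open>
  The axiom \<open>qinner_self\<close> says that \<open>\<langle>\<phi>|\<phi>\<rangle>\<close> is real, nonnegative, zero only at \<open>\<phi> = 0\<close>, and that
  the norm of the space is the one induced by the inner product. The axiom \<open>scaleR_eq_scaleQ\<close> ties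
  the real structure required by the superclass to the quaternionic one.
\<close>

class right_quaternionic_inner = real_normed_vector +
  fixes scaleQ :: "'a \<Rightarrow> quat \<Rightarrow> 'a"  (infixl \<open>*\<^sub>Q\<close> 75)
    and qinner :: "'a \<Rightarrow> 'a \<Rightarrow> quat"
  assumes scaleQ_add_left: "(x + y) *\<^sub>Q p = x *\<^sub>Q p + y *\<^sub>Q p"
    and scaleQ_add_right: "x *\<^sub>Q (p + q) = x *\<^sub>Q p + x *\<^sub>Q q"
    and scaleQ_scaleQ: "x *\<^sub>Q p *\<^sub>Q q = x *\<^sub>Q (p * q)"
    and scaleQ_one [simp]: "x *\<^sub>Q 1 = x"
    and scaleR_eq_scaleQ: "r *\<^sub>R x = x *\<^sub>Q of_real r"
    and qinner_cnj: "qcnj (qinner x y) = qinner y x"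
    and qinner_add_right: "qinner x (y + z) = qinner x y + qinner x z"
    and qinner_scaleQ_right: "qinner x (y *\<^sub>Q p) = qinner x y * p"
    and qinner_self: "qinner x x = of_real ((norm x)\<^sup>2)"

lemma qinner_add_left: "qinner (x + y) z = qinner x z + qinner y z"
  by (metis qinner_cnj qcnj_add qinner_add_right)

lemma qinner_scaleQ_left: "qinner (x *\<^sub>Q p) y = qcnj p * qinner x y"
  by (metis qinner_cnj qcnj_mult qinner_scaleQ_right)

class separable_right_quaternionic_hilbert = right_quaternionic_inner + complete_space +
  assumes separable: "separable_space (topology open)"

instance separable_right_quaternionic_hilbert \<subseteq> polish_space
proof
  obtain C :: "'a set" where C: "countable C" "closure C = UNIV"
    using separable by (auto simp: separable_space_def)
  define B where "B = (\<lambda>(c, n). ball c (inverse (real (Suc n)))) ` (C \<times> UNIV)"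
  have "countable B"
    unfolding B_def using C by auto
  moreover have "topological_basis B"
  proof (rule topological_basisI)
    show "open b" if "b \<in> B" for b
      using that by (auto simp: B_def)
    fix U and x :: 'a
    assume "open U" "x \<in> U"
    then obtain e where e: "e > 0" "ball x e \<subseteq> U"
      using open_contains_ball by blast
    obtain n where n: "inverse (real (Suc n)) < e / 2"
      using reals_Archimedean [of "e / 2"] e by auto
    have "x \<in> closure C"
      using C by simp
    then obtain c where c: "c \<in> C" "dist c x < inverse (real (Suc n))"
      unfolding closure_approachable by (meson inverse_positive_iff_positive of_nat_0_less_iff zero_less_Suc)
    have "ball c (inverse (real (Suc n))) \<subseteq> U"
    proof
      fix y assume "y \<in> ball c (inverse (real (Suc n)))"
      then have "dist c y < inverse (real (Suc n))"
        by simp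
      then have "dist x y < e"
        using c n dist_triangle [of x y c] by (simp add: dist_commute)
      then show "y \<in> U"
        using e by auto
    qed
    moreover have "x \<in> ball c (inverse (real (Suc n)))"
      using c by simp
    moreover have "ball c (inverse (real (Suc n))) \<in> B"
      using c by (auto simp: B_def)
    ultimately show "\<exists>b\<in>B. x \<in> b \<and> b \<subseteq> U"
      by blast
  qed
  ultimately show "\<exists>B :: 'a set set. countable B \<and> open = generate_topology B"
    using topological_basis_imp_subbasis by blast
qed

text \<open>The quaternions are a one-dimensional model.\<close>

instantiation quat :: separable_right_quaternionic_hilbert
begin

definition scaleQ_quat_def: "x *\<^sub>Q p = x * p" for x p :: quat

definition qinner_quat_def: "qinner x y = qcnj x * y" for x y :: quat

instance
proof
  fix x y z p q :: quat and r :: real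
  show "(x + y) *\<^sub>Q p = x *\<^sub>Q p + y *\<^sub>Q p" "x *\<^sub>Q (p + q) = x *\<^sub>Q p + x *\<^sub>Q q"
    "x *\<^sub>Q p *\<^sub>Q q = x *\<^sub>Q (p * q)" "x *\<^sub>Q 1 = x" "r *\<^sub>R x = x *\<^sub>Q of_real r"
    by (simp_all add: scaleQ_quat_def algebra_simps of_real_def)
  show "qcnj (qinner x y) = qinner y x"
    by (simp add: qinner_quat_def quat_eq_iff algebra_simps)
  show "qinner x (y + z) = qinner x y + qinner x z" "qinner x (y *\<^sub>Q p) = qinner x y * p"
    by (simp_all add: qinner_quat_def scaleQ_quat_def algebra_simps)
  show "qinner x x = of_real ((norm x)\<^sup>2)"
    by (simp only: qinner_quat_def qcnj_mult_self)
  obtain D :: "quat set" where D: "countable D" "\<And>X. open X \<Longrightarrow> X \<noteq> {} \<Longrightarrow> \<exists>d\<in>D. d \<in> X"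
    using countable_dense_setE by blast
  then have "closure D = UNIV"
    by (metis Int_iff Compl_empty_eq closure_subset disjoint_eq_subset_Compl double_complement
        emptyE open_Compl closed_closure)
  then show "separable_space (euclidean :: quat topology)"
    using D by (auto simp: separable_space_def)
qed

end


section \<open>Operators\<close>

definition right_linear :: "('a::right_quaternionic_inner \<Rightarrow> 'a) \<Rightarrow> bool" where
  "right_linear A \<longleftrightarrow> (\<forall>x y. A (x + y) = A x + A y) \<and> (\<forall>x p. A (x *\<^sub>Q p) = A x *\<^sub>Q p)"

definition bounded_right_linear :: "('a::right_quaternionic_inner \<Rightarrow> 'a) \<Rightarrow> bool" where
  "bounded_right_linear A \<longleftrightarrow> right_linear A \<and> (\<exists>K. \<forall>x. norm (A x) \<le> K * norm x)"

definition positive_operator :: "('a::right_quaternionic_inner \<Rightarrow> 'a) \<Rightarrow> bool" where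
  "positive_operator A \<longleftrightarrow> (\<forall>x. \<exists>r\<ge>0. qinner x (A x) = of_real r)"

definition has_bounded_inverse :: "('a::right_quaternionic_inner \<Rightarrow> 'a) \<Rightarrow> bool" where
  "has_bounded_inverse A \<longleftrightarrow> (\<exists>B. bounded_right_linear B \<and> A \<circ> B = id \<and> B \<circ> A = id)"

text \<open>
  The bounds \<open>m(A)\<close> and \<open>M(A)\<close>. They are only used for positive operators, where \<open>\<langle>\<phi>|A\<phi>\<rangle>\<close> is real,
  so that taking the real part is merely a change of type.
\<close>

definition operator_m :: "('a::right_quaternionic_inner \<Rightarrow> 'a) \<Rightarrow> real" where
  "operator_m A = (INF x\<in>{x. norm x = 1}. qRe (qinner x (A x)))"

definition operator_M :: "('a::right_quaternionic_inner \<Rightarrow> 'a) \<Rightarrow> real" where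
  "operator_M A = (SUP x\<in>{x. norm x = 1}. qRe (qinner x (A x)))"

text \<open>The rank-one operator \<open>|\<eta>\<rangle>\<langle>\<zeta>|\<close>.\<close>

definition ketbra :: "'a::right_quaternionic_inner \<Rightarrow> 'a \<Rightarrow> 'a \<Rightarrow> 'a" where
  "ketbra \<eta> \<zeta> = (\<lambda>\<phi>. \<eta> *\<^sub>Q qinner \<zeta> \<phi>)"

text \<open>The operator \<open>T\<close> is the weak integral of the operator-valued function \<open>F\<close>.\<close>

definition has_weak_integral ::
  "quat measure \<Rightarrow> (quat \<Rightarrow> 'a::right_quaternionic_inner \<Rightarrow> 'a) \<Rightarrow> ('a \<Rightarrow> 'a) \<Rightarrow> bool" where
  "has_weak_integral \<mu> F T \<longleftrightarrow>
     (\<forall>\<psi> \<phi>. has_bochner_integral \<mu> (\<lambda>q. qinner \<psi> (F q \<phi>)) (qinner \<psi> (T \<phi>)))"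


section \<open>Continuous frames of rank \<open>n\<close>\<close>

definition right_linearly_independent ::
  "nat \<Rightarrow> (nat \<Rightarrow> 'a::right_quaternionic_inner) \<Rightarrow> bool" where
  "right_linearly_independent n v \<longleftrightarrow>
     (\<forall>c. (\<Sum>i=1..n. v i *\<^sub>Q c i) = 0 \<longrightarrow> (\<forall>i\<in>{1..n}. c i = 0))"

definition is_frame_operator ::
  "quat measure \<Rightarrow> nat \<Rightarrow> (nat \<Rightarrow> quat \<Rightarrow> 'a::right_quaternionic_inner) \<Rightarrow> ('a \<Rightarrow> 'a) \<Rightarrow> bool" where
  "is_frame_operator \<mu> n \<eta> A \<longleftrightarrow>
     bounded_right_linear A \<and> positive_operator A \<and> has_bounded_inverse A \<and>
     (\<exists>T. (\<forall>i\<in>{1..n}. has_weak_integral \<mu> (\<lambda>q. ketbra (\<eta> i q) (\<eta> i q)) (T i)) \<and>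
          (\<forall>\<phi>. (\<Sum>i=1..n. T i \<phi>) = A \<phi>))"

definition measurable_family ::
  "quat measure \<Rightarrow> nat \<Rightarrow> (nat \<Rightarrow> quat \<Rightarrow> 'a::topological_space) \<Rightarrow> bool" where
  "measurable_family \<mu> n \<eta> \<longleftrightarrow> (\<forall>i\<in>{1..n}. \<eta> i \<in> borel_measurable \<mu>)"

definition rank_right_quaternionic_continuous_frame ::
  "quat measure \<Rightarrow> nat \<Rightarrow> (nat \<Rightarrow> quat \<Rightarrow> 'a::right_quaternionic_inner) \<Rightarrow> bool" where
  "rank_right_quaternionic_continuous_frame \<mu> n \<eta> \<longleftrightarrow>
     measurable_family \<mu> n \<eta> \<and>
     (\<forall>q. right_linearly_independent n (\<lambda>i. \<eta> i q)) \<and>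
     (\<exists>A. is_frame_operator \<mu> n \<eta> A)"

text \<open>
  The frame inequalities are stated with nonnegative extended integrals, so the upper bound includes
  the finiteness of every integral.
\<close>

definition rank_continuous_frame ::
  "quat measure \<Rightarrow> nat \<Rightarrow> (nat \<Rightarrow> quat \<Rightarrow> 'a::right_quaternionic_inner) \<Rightarrow> bool" where
  "rank_continuous_frame \<mu> n \<xi> \<longleftrightarrow>
     measurable_family \<mu> n \<xi> \<and>
     (\<exists>C>0. \<exists>D>0. \<forall>\<phi>.
        ennreal (C * (norm \<phi>)\<^sup>2) \<le> (\<Sum>i=1..n. \<integral>\<^sup>+ q. ennreal ((norm (qinner (\<xi> i q) \<phi>))\<^sup>2) \<partial>\<mu>) \<and>
        (\<Sum>i=1..n. \<integral>\<^sup>+ q. ennreal ((norm (qinner (\<xi> i q) \<phi>))\<^sup>2) \<partial>\<mu>) \<le> ennreal (D * (norm \<phi>)\<^sup>2))"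

end

theory Submission
  imports Defs
begin

text \<open>
  Put \<open>\<delta> = \<eta> - \<zeta>\<close>, so that \<open>\<eta> + \<zeta> = 2\<eta> - \<delta>\<close>. Cauchy--Schwarz bounds the frame sum of \<open>\<delta>\<close> at \<open>\<phi>\<close> by
  \<open>s \<parallel>\<phi>\<parallel>\<^sup>2\<close>, where \<open>s = \<Sum>\<integral>\<parallel>\<delta>\<parallel>\<^sup>2 < m(A)\<close>. The parallelogram law gives pointwise
  \<open>2 |x|\<^sup>2 \<le> |2x - y|\<^sup>2 + |y|\<^sup>2\<close>, so that \<open>2 m(A) - s > m(A)\<close> is a lower frame bound, and
  \<open>|2x - y|\<^sup>2 \<le> 8 |x|\<^sup>2 + 2 |y|\<^sup>2\<close> gives an upper one.
\<close>

lemma norm_qcnj [simp]: "norm (qcnj x) = norm x"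
  by (simp add: norm_quat_def)

text \<open>Allows the real part to be moved through Bochner integrals and finite sums, turning
  quaternion-valued weak integrals into real ones.\<close>

lemma bounded_linear_qRe: "bounded_linear qRe"
proof (rule bounded_linear_intro[where K = 1])
  fix x :: quat
  show "norm (qRe x) \<le> norm x * 1"
    unfolding norm_quat_def by (auto intro!: real_le_rsqrt)
qed simp_all

lemma qRe_le_norm: "qRe x \<le> norm x"
  unfolding norm_quat_def by (rule real_le_rsqrt) simp

lemma qinner_zero_right [simp]: "qinner x 0 = 0"
  using qinner_add_right[of x 0 0] by simp

lemma qinner_zero_left [simp]: "qinner 0 x = 0"
  using qinner_add_left[of 0 0 x] by simp

lemma qinner_minus_left: "qinner (x - y) z = qinner x z - qinner y z"
  using qinner_add_left[of "x - y" y z] by simp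

lemma qinner_minus_right: "qinner x (y - z) = qinner x y - qinner x z"
  using qinner_add_right[of x "y - z" z] by simp

lemma qinner_sum_right: "qinner x (\<Sum>i\<in>I. f i) = (\<Sum>i\<in>I. qinner x (f i))"
  by (induction I rule: infinite_finite_induct) (simp_all add: qinner_add_right)

lemma qinner_scaleR_right: "qinner x (r *\<^sub>R y) = r *\<^sub>R qinner x y"
  by (simp add: scaleR_eq_scaleQ[of r y] qinner_scaleQ_right of_real_def)

lemma qinner_scaleR_left: "qinner (r *\<^sub>R x) y = r *\<^sub>R qinner x y"
proof -
  have "qcnj (of_real r) = of_real r"
    by (simp add: quat_eq_iff)
  then show ?thesis
    by (simp add: scaleR_eq_scaleQ[of r x] qinner_scaleQ_left of_real_def)
qed

text \<open>The product has the form \<open>qcnj z * z\<close> with \<open>z = qinner x y\<close>.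
  With \<open>y = \<phi>\<close> and \<open>x = \<eta> i q\<close> it is the matrix element of the
  rank-one operator at \<open>\<phi>\<close>, hence the integrand of the frame sum.\<close>

lemma qinner_swap_mult: "qinner y x * qinner x y = of_real ((norm (qinner x y))\<^sup>2)"
  by (metis qcnj_mult_self qinner_cnj)

text \<open>Cauchy--Schwarz, from nonnegativity of the squared norm of the component of
  \<open>y\<close> orthogonal to \<open>x\<close>. That component is scaled by
  \<open>(norm x)\<^sup>2\<close>, so no division occurs, and the coefficient \<open>p\<close>
  stands to the right of \<open>x\<close>.\<close>

lemma norm_qinner_le: "norm (qinner x y) \<le> norm x * norm y"
proof (cases "x = 0")
  case False
  define p where "p = qinner x y"
  define z where "z = (norm x)\<^sup>2 *\<^sub>R y - x *\<^sub>Q p"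
  have xz: "qinner x z = 0"
    by (simp add: z_def qinner_minus_right qinner_scaleR_right qinner_scaleQ_right qinner_self
        p_def scaleR_conv_of_real)
  have "of_real ((norm z)\<^sup>2) = qinner z z"
    by (simp add: qinner_self)
  \<comment> \<open>Since \<open>z\<close> is orthogonal to \<open>x\<close>, only the multiple of
    \<open>y\<close> in the left argument contributes.\<close>
  also have "\<dots> = (norm x)\<^sup>2 *\<^sub>R qinner y z"
    by (subst (1) z_def) (simp add: qinner_minus_left qinner_scaleR_left qinner_scaleQ_left xz)
  also have "qinner y z = of_real ((norm x)\<^sup>2 * (norm y)\<^sup>2 - (norm p)\<^sup>2)"
    unfolding z_def qinner_minus_right qinner_scaleR_right qinner_scaleQ_right qinner_self
      p_def qinner_swap_mult
    by (simp add: scaleR_conv_of_real)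
  finally have "(of_real ((norm z)\<^sup>2) :: quat)
      = of_real ((norm x)\<^sup>2 * ((norm x)\<^sup>2 * (norm y)\<^sup>2 - (norm p)\<^sup>2))"
    by (simp add: scaleR_conv_of_real)
  then have "0 \<le> (norm x)\<^sup>2 * ((norm x)\<^sup>2 * (norm y)\<^sup>2 - (norm p)\<^sup>2)"
    by (metis of_real_eq_iff zero_le_power2)
  then have "(norm p)\<^sup>2 \<le> (norm x * norm y)\<^sup>2"
    using False by (simp add: zero_le_mult_iff power_mult_distrib)
  then show ?thesis
    unfolding p_def by (rule power2_le_imp_le) simp
qed simp

text \<open>The left slot is conjugate-linear over the quaternions but linear over the reals, and
  Cauchy--Schwarz makes it bounded; measurability then follows from continuity.\<close>

lemma borel_measurable_qinner_left [measurable (raw)]: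
  assumes "f \<in> borel_measurable M"
  shows "(\<lambda>q. qinner (f q) y) \<in> borel_measurable M"
proof -
  have "bounded_linear (\<lambda>x. qinner x y)"
    by (rule bounded_linear_intro[where K = "norm y"])
      (simp_all add: qinner_add_left qinner_scaleR_left norm_qinner_le)
  then show ?thesis
    using assms
    by (intro borel_measurable_continuous_on[where f = "\<lambda>x. qinner x y"] linear_continuous_on)
qed

text \<open>Extended nonnegative values allow estimates for \<open>\<xi>\<close> and
  \<open>\<delta>\<close> before any integrability of their inner products is known.\<close>

abbreviation frame_sum ::
  "quat measure \<Rightarrow> nat \<Rightarrow> (nat \<Rightarrow> quat \<Rightarrow> 'a::right_quaternionic_inner) \<Rightarrow> 'a \<Rightarrow> ennreal" where
  "frame_sum \<mu> n \<xi> \<phi> \<equiv> \<Sum>i=1..n. \<integral>\<^sup>+ q. ennreal ((norm (qinner (\<xi> i q) \<phi>))\<^sup>2) \<partial>\<mu>"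

text \<open>Testing each weak integral with the same vector \<open>\<phi>\<close> on both sides
  makes the integrand the real number |<\<eta>|\<phi>>|^2; Bochner integrability then identifies the
  extended integral with the real one.\<close>

lemma frame_sum_eq_frame_operator:
  assumes "is_frame_operator \<mu> n \<eta> A"
  shows "frame_sum \<mu> n \<eta> \<phi> = ennreal (qRe (qinner \<phi> (A \<phi>)))"
proof -
  obtain T where
    T: "\<And>i. i \<in> {1..n} \<Longrightarrow> has_weak_integral \<mu> (\<lambda>q. ketbra (\<eta> i q) (\<eta> i q)) (T i)"
    and sum_T: "\<And>\<phi>. (\<Sum>i=1..n. T i \<phi>) = A \<phi>"
    using assms unfolding is_frame_operator_def by blast
  have bochner: "has_bochner_integral \<mu> (\<lambda>q. (norm (qinner (\<eta> i q) \<phi>))\<^sup>2) (qRe (qinner \<phi> (T i \<phi>)))"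
    if "i \<in> {1..n}" for i
  proof -
    have "has_bochner_integral \<mu> (\<lambda>q. qinner \<phi> (ketbra (\<eta> i q) (\<eta> i q) \<phi>)) (qinner \<phi> (T i \<phi>))"
      using T[OF that] unfolding has_weak_integral_def by blast
    from has_bochner_integral_bounded_linear[OF bounded_linear_qRe this] show ?thesis
      by (simp only: ketbra_def qinner_scaleQ_right qinner_swap_mult of_real_quat_sel)
  qed
  \<comment> \<open>\<open>ennreal\<close> truncates negative reals to 0, so adding the values needs
    each term nonnegative. Positivity of \<open>A\<close> controls only their sum; the sign of each
    term comes from its integrand.\<close>
  have nonneg: "0 \<le> qRe (qinner \<phi> (T i \<phi>))" if "i \<in> {1..n}" for i
    using Bochner_Integration.integral_nonneg[of \<mu> "\<lambda>q. (norm (qinner (\<eta> i q) \<phi>))\<^sup>2"]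
      has_bochner_integral_integral_eq[OF bochner[OF that]] by simp
  have "frame_sum \<mu> n \<eta> \<phi> = (\<Sum>i=1..n. ennreal (qRe (qinner \<phi> (T i \<phi>))))"
    using bochner nonneg
    by (intro sum.cong refl) (simp add: has_bochner_integral_iff nn_integral_eq_integral)
  also have "\<dots> = ennreal (\<Sum>i=1..n. qRe (qinner \<phi> (T i \<phi>)))"
    using nonneg by (rule sum_ennreal)
  also have "(\<Sum>i=1..n. qRe (qinner \<phi> (T i \<phi>))) = qRe (\<Sum>i=1..n. qinner \<phi> (T i \<phi>))"
    by (rule linear_sum[symmetric]) (rule bounded_linear.linear[OF bounded_linear_qRe])
  also have "(\<Sum>i=1..n. qinner \<phi> (T i \<phi>)) = qinner \<phi> (A \<phi>)"
    by (simp only: sum_T flip: qinner_sum_right)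
  finally show ?thesis .
qed

text \<open>Both sides are homogeneous of degree 2, so the claim reduces to the unit vector
  \<open>u\<close>, where the infimum applies.\<close>

lemma operator_m_le:
  assumes "right_linear A" and "positive_operator A"
  shows "operator_m A * (norm x)\<^sup>2 \<le> qRe (qinner x (A x))"
proof (cases "x = 0")
  case False
  define r u where "r = norm x" and "u = x /\<^sub>R norm x"
  have x: "x = r *\<^sub>R u" and u: "norm u = 1"
    using False by (simp_all add: r_def u_def)
  \<comment> \<open>Positivity supplies the lower bound 0 that makes the real \<open>INF\<close> a
    genuine infimum.\<close>
  have "qRe (qinner x (A x)) \<ge> 0" for x
    using assms(2) unfolding positive_operator_def by (metis of_real_quat_sel(1))
  then have "bdd_below ((\<lambda>x. qRe (qinner x (A x))) ` {x. norm x = 1})"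
    by (intro bdd_belowI2[where m = 0])
  then have "operator_m A \<le> qRe (qinner u (A u))"
    unfolding operator_m_def using u by (intro cINF_lower) simp_all
  then have "operator_m A * r\<^sup>2 \<le> qRe (qinner u (A u)) * r\<^sup>2"
    by (rule mult_right_mono) simp
  also have "A (r *\<^sub>R u) = r *\<^sub>R A u"
    using assms(1) by (simp add: right_linear_def scaleR_eq_scaleQ)
  then have "qRe (qinner u (A u)) * r\<^sup>2 = qRe (qinner x (A x))"
    unfolding x by (simp add: qinner_scaleR_left qinner_scaleR_right power2_eq_square)
  finally show ?thesis
    by (simp add: r_def)
qed simp

text \<open>Cauchy--Schwarz under each integral; the factor depending on \<open>\<phi>\<close> is
  constant in \<open>q\<close> and comes out.\<close>

lemma frame_sum_le_norm:
  fixes \<delta> :: "nat \<Rightarrow> quat \<Rightarrow> 'a::separable_right_quaternionic_hilbert"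
  assumes "measurable_family \<mu> n \<delta>"
  shows "frame_sum \<mu> n \<delta> \<phi>
    \<le> (\<Sum>i=1..n. \<integral>\<^sup>+ q. ennreal ((norm (\<delta> i q))\<^sup>2) \<partial>\<mu>) * ennreal ((norm \<phi>)\<^sup>2)"
  unfolding sum_distrib_right
proof (rule sum_mono)
  fix i assume i: "i \<in> {1..n}"
  have [measurable]: "\<delta> i \<in> borel_measurable \<mu>"
    using assms i unfolding measurable_family_def by blast
  have "(\<integral>\<^sup>+ q. ennreal ((norm (qinner (\<delta> i q) \<phi>))\<^sup>2) \<partial>\<mu>)
      \<le> (\<integral>\<^sup>+ q. ennreal ((norm (\<delta> i q))\<^sup>2) * ennreal ((norm \<phi>)\<^sup>2) \<partial>\<mu>)"
    by (intro nn_integral_mono)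
      (simp add: norm_qinner_le power_mono flip: ennreal_mult power_mult_distrib)
  also have "\<dots> = (\<integral>\<^sup>+ q. ennreal ((norm (\<delta> i q))\<^sup>2) \<partial>\<mu>) * ennreal ((norm \<phi>)\<^sup>2)"
    by (rule nn_integral_multc) measurable
  finally show "(\<integral>\<^sup>+ q. ennreal ((norm (qinner (\<delta> i q) \<phi>))\<^sup>2) \<partial>\<mu>)
      \<le> (\<integral>\<^sup>+ q. ennreal ((norm (\<delta> i q))\<^sup>2) \<partial>\<mu>) * ennreal ((norm \<phi>)\<^sup>2)" .
qed

text \<open>Integrates a pointwise quadratic estimate. It serves for both frame bounds; keeping all
  terms additive avoids subtraction between possibly infinite integrals.\<close>

lemma frame_sum_mono_add:
  fixes \<alpha> \<beta> \<gamma> :: "nat \<Rightarrow> quat \<Rightarrow> 'a::separable_right_quaternionic_hilbert"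
  assumes "measurable_family \<mu> n \<alpha>" and "measurable_family \<mu> n \<beta>" and "measurable_family \<mu> n \<gamma>"
    and "0 \<le> a" and "0 \<le> b" and "0 \<le> c"
    and bound: "\<And>i q. a * (norm (qinner (\<alpha> i q) \<phi>))\<^sup>2
      \<le> b * (norm (qinner (\<beta> i q) \<phi>))\<^sup>2 + c * (norm (qinner (\<gamma> i q) \<phi>))\<^sup>2"
  shows "ennreal a * frame_sum \<mu> n \<alpha> \<phi>
    \<le> ennreal b * frame_sum \<mu> n \<beta> \<phi> + ennreal c * frame_sum \<mu> n \<gamma> \<phi>"
  unfolding sum_distrib_left sum.distrib[symmetric]
proof (rule sum_mono)
  fix i assume i: "i \<in> {1..n}"
  have [measurable]: "\<alpha> i \<in> borel_measurable \<mu>" "\<beta> i \<in> borel_measurable \<mu>"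
      "\<gamma> i \<in> borel_measurable \<mu>"
    using assms(1-3)[unfolded measurable_family_def, THEN bspec, OF i] .
  have "(\<integral>\<^sup>+ q. ennreal a * ennreal ((norm (qinner (\<alpha> i q) \<phi>))\<^sup>2) \<partial>\<mu>)
      \<le> (\<integral>\<^sup>+ q. ennreal b * ennreal ((norm (qinner (\<beta> i q) \<phi>))\<^sup>2)
            + ennreal c * ennreal ((norm (qinner (\<gamma> i q) \<phi>))\<^sup>2) \<partial>\<mu>)"
    using assms(4-6) bound
    by (intro nn_integral_mono) (simp flip: ennreal_mult ennreal_plus)
  then show "ennreal a * (\<integral>\<^sup>+ q. ennreal ((norm (qinner (\<alpha> i q) \<phi>))\<^sup>2) \<partial>\<mu>)
      \<le> ennreal b * (\<integral>\<^sup>+ q. ennreal ((norm (qinner (\<beta> i q) \<phi>))\<^sup>2) \<partial>\<mu>)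
        + ennreal c * (\<integral>\<^sup>+ q. ennreal ((norm (qinner (\<gamma> i q) \<phi>))\<^sup>2) \<partial>\<mu>)"
    by (simp add: nn_integral_add nn_integral_cmult)
qed

theorem theorem3p2:
  fixes \<mu> :: "quat measure"
    and n :: nat
    and \<eta> \<zeta> :: "nat \<Rightarrow> quat \<Rightarrow> 'v::separable_right_quaternionic_hilbert"
    and A :: "'v \<Rightarrow> 'v"
  assumes "space \<mu> = UNIV"
    and "n \<ge> 1"
    and "rank_right_quaternionic_continuous_frame \<mu> n \<eta>"
    and "is_frame_operator \<mu> n \<eta> A"
    and "measurable_family \<mu> n \<zeta>"
    and "(\<Sum>i=1..n. \<integral>\<^sup>+ q. ennreal ((norm (\<eta> i q - \<zeta> i q))\<^sup>2) \<partial>\<mu>) < ennreal (operator_m A)"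
  shows "rank_continuous_frame \<mu> n (\<lambda>i q. \<eta> i q + \<zeta> i q)"
proof -
  define \<xi> where "\<xi> = (\<lambda>i q. \<eta> i q + \<zeta> i q)"
  define \<delta> where "\<delta> = (\<lambda>i q. \<eta> i q - \<zeta> i q)"
  define m where "m = operator_m A"
  have meas_\<eta>: "measurable_family \<mu> n \<eta>"
    using assms(3) unfolding rank_right_quaternionic_continuous_frame_def by blast
  have meas_\<xi>: "measurable_family \<mu> n \<xi>" and meas_\<delta>: "measurable_family \<mu> n \<delta>"
    using meas_\<eta> assms(5) unfolding measurable_family_def \<xi>_def \<delta>_def
    by (auto intro!: borel_measurable_add borel_measurable_diff)
  have lin: "right_linear A" and pos: "positive_operator A"
    using assms(4) unfolding is_frame_operator_def bounded_right_linear_def by blast+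
  obtain K where K: "\<And>x. norm (A x) \<le> K * norm x"
    using assms(4) unfolding is_frame_operator_def bounded_right_linear_def by blast
  \<comment> \<open>The total deviation lies strictly below a finite value, so it is a real
    number.\<close>
  obtain s where s0: "0 \<le> s"
    and s: "(\<Sum>i=1..n. \<integral>\<^sup>+ q. ennreal ((norm (\<delta> i q))\<^sup>2) \<partial>\<mu>) = ennreal s"
    using less_trans[OF assms(6) ennreal_less_top] unfolding \<delta>_def less_top_ennreal by blast
  have sm: "s < m"
    using assms(6) s s0 by (simp add: \<delta>_def m_def ennreal_less_iff)
  \<comment> \<open>\<open>K\<close> carries no sign assumption; its absolute value makes the
    monotonicity steps valid.\<close>
  have A_upper: "qRe (qinner \<phi> (A \<phi>)) \<le> \<bar>K\<bar> * (norm \<phi>)\<^sup>2" for \<phi>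
  proof -
    have "qRe (qinner \<phi> (A \<phi>)) \<le> norm \<phi> * norm (A \<phi>)"
      using qRe_le_norm norm_qinner_le by (rule order_trans)
    also have "\<dots> \<le> norm \<phi> * (\<bar>K\<bar> * norm \<phi>)"
      by (intro mult_left_mono order_trans[OF K] mult_right_mono) simp_all
    finally show ?thesis
      by (simp add: power2_eq_square mult_ac)
  qed
  have frame_\<delta>: "frame_sum \<mu> n \<delta> \<phi> \<le> ennreal (s * (norm \<phi>)\<^sup>2)" for \<phi>
    using frame_sum_le_norm[OF meas_\<delta>, of \<phi>] s s0 by (simp add: ennreal_mult)
  have expand: "qinner (\<xi> i q) \<phi> = 2 *\<^sub>R qinner (\<eta> i q) \<phi> - qinner (\<delta> i q) \<phi>" for i q \<phi>
    unfolding \<xi>_def \<delta>_def by (simp add: qinner_add_left qinner_minus_left scaleR_2)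
  \<comment> \<open>Parallelogram law for \<open>x\<close> and \<open>x - y\<close>, whose sum and
    difference are \<open>2 *\<^sub>R x - y\<close> and \<open>y\<close>.\<close>
  have lower_pointwise: "2 * (norm x)\<^sup>2 \<le> (norm (2 *\<^sub>R x - y))\<^sup>2 + (norm y)\<^sup>2" for x y :: quat
  proof -
    have "(norm (2 *\<^sub>R x - y))\<^sup>2 + (norm y)\<^sup>2 - 2 * (norm x)\<^sup>2 = 2 * (norm (x - y))\<^sup>2"
      by (simp add: power2_norm_eq_inner inner_diff_left inner_diff_right inner_commute)
    then show ?thesis
      by (smt (verit) zero_le_power2)
  qed
  \<comment> \<open>Parallelogram law for \<open>2 *\<^sub>R x\<close> and \<open>y\<close>,
    discarding the square of the norm of their sum.\<close>
  have upper_pointwise: "(norm (2 *\<^sub>R x - y))\<^sup>2 \<le> 8 * (norm x)\<^sup>2 + 2 * (norm y)\<^sup>2" for x y :: quat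
  proof -
    have "8 * (norm x)\<^sup>2 + 2 * (norm y)\<^sup>2 - (norm (2 *\<^sub>R x - y))\<^sup>2 = (norm (2 *\<^sub>R x + y))\<^sup>2"
      by (simp add: power2_norm_eq_inner inner_diff_left inner_diff_right inner_add_left
          inner_add_right inner_commute)
    then show ?thesis
      by (smt (verit) zero_le_power2)
  qed
  have lower: "ennreal ((2 * m - s) * (norm \<phi>)\<^sup>2) \<le> frame_sum \<mu> n \<xi> \<phi>" for \<phi>
  proof -
    have "ennreal (2 * m * (norm \<phi>)\<^sup>2) \<le> ennreal (2 * qRe (qinner \<phi> (A \<phi>)))"
      using operator_m_le[OF lin pos, of \<phi>] by (intro ennreal_leI) (simp add: m_def)
    also have "\<dots> = ennreal 2 * frame_sum \<mu> n \<eta> \<phi>"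
      by (simp only: frame_sum_eq_frame_operator[OF assms(4)] ennreal_mult' zero_le_numeral)
    also have "\<dots> \<le> ennreal 1 * frame_sum \<mu> n \<xi> \<phi> + ennreal 1 * frame_sum \<mu> n \<delta> \<phi>"
      by (rule frame_sum_mono_add[OF meas_\<eta> meas_\<xi> meas_\<delta>])
        (simp_all add: expand lower_pointwise)
    also have "\<dots> \<le> frame_sum \<mu> n \<xi> \<phi> + ennreal (s * (norm \<phi>)\<^sup>2)"
      using frame_\<delta>[of \<phi>] by (simp add: add_left_mono)
    \<comment> \<open>The \<open>\<delta>\<close> contribution was first replaced by a finite bound,
      so it can be moved across the inequality.\<close>
    finally have "ennreal (2 * m * (norm \<phi>)\<^sup>2) - ennreal (s * (norm \<phi>)\<^sup>2) \<le> frame_sum \<mu> n \<xi> \<phi>"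
      by (simp add: ennreal_minus_le_iff add.commute)
    then show ?thesis
      using s0 by (simp add: ennreal_minus left_diff_distrib)
  qed
  \<comment> \<open>The summand 1 keeps the constant strictly positive, as a frame bound must be,
    even should \<open>K\<close> and \<open>s\<close> both vanish.\<close>
  have upper: "frame_sum \<mu> n \<xi> \<phi> \<le> ennreal ((8 * \<bar>K\<bar> + 2 * s + 1) * (norm \<phi>)\<^sup>2)" for \<phi>
  proof -
    have "ennreal 1 * frame_sum \<mu> n \<xi> \<phi>
        \<le> ennreal 8 * frame_sum \<mu> n \<eta> \<phi> + ennreal 2 * frame_sum \<mu> n \<delta> \<phi>"
      by (rule frame_sum_mono_add[OF meas_\<xi> meas_\<eta> meas_\<delta>])
        (simp_all add: expand upper_pointwise)
    also have "\<dots> \<le> ennreal 8 * ennreal (\<bar>K\<bar> * (norm \<phi>)\<^sup>2) + ennreal 2 * ennreal (s * (norm \<phi>)\<^sup>2)"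
      unfolding frame_sum_eq_frame_operator[OF assms(4)]
      by (intro add_mono mult_left_mono frame_\<delta> ennreal_leI A_upper) simp_all
    also have "\<dots> = ennreal ((8 * \<bar>K\<bar> + 2 * s) * (norm \<phi>)\<^sup>2)"
      using s0 by (simp add: distrib_right mult.assoc del: ennreal_numeral flip: ennreal_mult ennreal_plus)
    also have "\<dots> \<le> ennreal ((8 * \<bar>K\<bar> + 2 * s + 1) * (norm \<phi>)\<^sup>2)"
      by (intro ennreal_leI mult_right_mono) simp_all
    finally show ?thesis
      by simp
  qed
  have "0 < 2 * m - s" "0 < 8 * \<bar>K\<bar> + 2 * s + 1"
    using sm s0 by linarith+
  then show ?thesis
    using meas_\<xi> lower upper unfolding rank_continuous_frame_def \<xi>_def by blast
qed

end
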